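(* Let $n\ge1$ be an integer, $p\in(0,1)$, $q=1-p$, and $Z\sim\operatorname{Bin}(n,p)$. For $A\subseteq\{0,\dots,n\}$ let $f_A:\{0,\dots,n\}\to\mathbb R$ be the solution with $f_A(0)=0$ of $$p(n-k)f_A(k+1)-qk f_A(k)=\mathbf 1_A(k)-\mathbb P(Z\in A),\qquad 0\le k\le n$$ (the term with $f_A(n+1)$ having coefficient $0$), and let $C_0^{\rm Bin}(n,p):=\sup_A\|f_A\|_\infty$. Then $$C_0^{\rm Bin}(n,p)\le\min\left\{1,\frac1{\sqrt{2(n+1)pq}}\right\}.$$ For $n\ge2$, put $s:=\min\{p,q\}$, $t:=\max\{p,q\}$ and $$\kappa_{n,p}^{\rm Bin}:=\min_{1\le k\le n-1}\left[\{k-(n+1)s\}^2+\left\{\frac{st(n+1-2k)}{tk+s(n-k+1)}\right\}^2\right].$$ Then $$C_0^{\rm Bin}(n,p)\le\min\left\{1,\frac1{\sqrt{2(n+1)pq+\kappa_{n,p}^{\rm Bin}}}\right\}.$$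
   Context: $\|f\|_\infty=\max_{0\le k\le n}|f(k)|$. In the definition of $\kappa_{n,p}^{\rm Bin}$ the minimum is over integers $k$. *)

theory Defs
  imports "HOL-Probability.Probability"
begin

text \<open>
  Functions on \<open>{0..n}\<close> are represented by functions on \<open>nat\<close> that are \<open>undefined\<close> outside
  \<open>{0..n}\<close>, so that the solution is unique as a HOL function. The value \<open>f (n + 1)\<close>
  only occurs in the equation with coefficient \<open>0\<close>.
\<close>

definition is_binomial_stein_solution :: "nat \<Rightarrow> real \<Rightarrow> nat set \<Rightarrow> (nat \<Rightarrow> real) \<Rightarrow> bool" where
  "is_binomial_stein_solution n p A f \<longleftrightarrow>
     f \<in> extensional {0..n} \<and> f 0 = 0 \<and>
     (\<forall>k\<in>{0..n}. p * (real n - real k) * f (k + 1) - (1 - p) * real k * f k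
                   = indicator A k - measure_pmf.prob (binomial_pmf n p) A)"

definition binomial_stein_solution :: "nat \<Rightarrow> real \<Rightarrow> nat set \<Rightarrow> nat \<Rightarrow> real" where
  "binomial_stein_solution n p A = (THE f. is_binomial_stein_solution n p A f)"

definition max_norm :: "nat \<Rightarrow> (nat \<Rightarrow> real) \<Rightarrow> real" where
  "max_norm n f = (MAX k\<in>{0..n}. \<bar>f k\<bar>)"

definition C0_Bin :: "nat \<Rightarrow> real \<Rightarrow> real" where
  "C0_Bin n p = (SUP A\<in>Pow {0..n}. max_norm n (binomial_stein_solution n p A))"

definition kappa_Bin :: "nat \<Rightarrow> real \<Rightarrow> real" where
  "kappa_Bin n p =
     (let s = min p (1 - p); t = max p (1 - p) in
      MIN k\<in>{1..n - 1}.
        (real k - (real n + 1) * s)\<^sup>2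
        + (s * t * (real n + 1 - 2 * real k) / (t * real k + s * (real n - real k + 1)))\<^sup>2)"

text \<open>The definite description is well defined in the parameter range of interest.\<close>

lemma ex1_binomial_stein_solution:
  assumes p: "0 < p" "p < 1" and A: "A \<subseteq> {0..n}"
  shows "\<exists>!f. is_binomial_stein_solution n p A f"
proof (rule ex_ex1I)
  define w where "w k = pmf (binomial_pmf n p) k" for k
  define P where "P = measure_pmf.prob (binomial_pmf n p) A"
  define h where "h k = indicator A k - P" for k
  define S where "S k = (\<Sum>j<k. w j * h j)" for k
  define f where "f = restrict (\<lambda>k. S k / ((1 - p) * real k * w k)) {0..n}"
  have w: "w k = real (n choose k) * p ^ k * (1 - p) ^ (n - k)" for k
    using p by (simp add: w_def)
  have w_pos: "w k > 0" if "k \<le> n" for k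
    using that p by (simp add: w)
  have sum_w: "(\<Sum>k\<le>n. w k) = 1"
    unfolding w using binomial_ring[of p "1 - p" n] by simp
  have P: "P = (\<Sum>k\<le>n. w k * indicator A k)"
  proof -
    have "finite A" using A finite_subset by blast
    then have "P = (\<Sum>k\<in>A. w k)"
      by (simp add: P_def w_def measure_measure_pmf_finite)
    also have "\<dots> = (\<Sum>k\<le>n. w k * indicator A k)"
      using A by (intro sum.mono_neutral_cong_left) (auto simp: indicator_def)
    finally show ?thesis .
  qed
  have S_end: "S (Suc n) = 0"
    unfolding S_def lessThan_Suc_atMost h_def
    by (simp add: right_diff_distrib sum_subtractf P[symmetric] flip: sum_distrib_right)
      (simp add: sum_w)
  have rec: "p * (real n - real k) * w k = (1 - p) * real (Suc k) * w (Suc k)" if "k < n" for k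
  proof -
    have 1: "real (Suc k) * real (n choose Suc k) = (real n - real k) * real (n choose k)"
      using that binomial_absorb_comp[of n k] binomial_absorption[of k n]
      by (metis binomial_absorption less_or_eq_imp_le of_nat_diff of_nat_mult)
    have 2: "(1 - p) ^ (n - k) = (1 - p) * (1 - p) ^ (n - Suc k)"
      using that by (metis Suc_diff_Suc power_Suc)
    have "(1 - p) * real (Suc k) * w (Suc k)
        = (real (Suc k) * real (n choose Suc k)) * (p * p ^ k) * ((1 - p) * (1 - p) ^ (n - Suc k))"
      by (simp add: w)
    also have "\<dots> = p * (real n - real k) * w k"
      unfolding 1 2[symmetric] by (simp add: w)
    finally show ?thesis by simp
  qed
  have "p * (real n - real k) * f (k + 1) - (1 - p) * real k * f k = h k" if k: "k \<le> n" for k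
  proof -
    have a: "w k * (p * (real n - real k) * f (k + 1)) = S (Suc k)"
    proof (cases "k < n")
      case True
      have "w k * (p * (real n - real k) * f (k + 1))
          = ((1 - p) * real (Suc k) * w (Suc k)) * f (Suc k)"
        unfolding rec[OF True, symmetric] by simp
      also have "\<dots> = S (Suc k)"
        using w_pos[of "Suc k"] True p by (simp add: f_def)
      finally show ?thesis .
    next
      case False
      then show ?thesis using k S_end by simp
    qed
    have b: "w k * ((1 - p) * real k * f k) = S k"
      using w_pos[of k] k p by (cases "k = 0") (auto simp: f_def S_def)
    have "w k * (p * (real n - real k) * f (k + 1) - (1 - p) * real k * f k) = S (Suc k) - S k"
      by (subst right_diff_distrib) (simp only: a b)
    also have "\<dots> = w k * h k"
      by (simp add: S_def)
    finally have "w k * (p * (real n - real k) * f (k + 1) - (1 - p) * real k * f k) = w k * h k" .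
    then show ?thesis using w_pos[OF k] by simp
  qed
  then have "is_binomial_stein_solution n p A f"
    by (auto simp: is_binomial_stein_solution_def h_def P_def f_def S_def)
  then show "\<exists>f. is_binomial_stein_solution n p A f" by blast
next
  fix f g
  assume f: "is_binomial_stein_solution n p A f" and g: "is_binomial_stein_solution n p A g"
  have "k \<le> n \<Longrightarrow> f k = g k" for k
  proof (induction k)
    case 0
    then show ?case using f g by (simp add: is_binomial_stein_solution_def)
  next
    case (Suc k)
    let ?r = "indicator A k - measure_pmf.prob (binomial_pmf n p) A"
    have "p * (real n - real k) * f (k + 1) - (1 - p) * real k * f k = ?r"
      and "p * (real n - real k) * g (k + 1) - (1 - p) * real k * g k = ?r"
      using f g Suc.prems by (auto simp: is_binomial_stein_solution_def)
    then have "p * (real n - real k) * f (k + 1) = p * (real n - real k) * g (k + 1)"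
      using Suc.IH Suc.prems by (metis Suc_leD diff_add_cancel)
    then show ?case using p Suc.prems by simp
  qed
  then show "f = g"
    using f g by (intro extensionalityI[of f "{0..n}" g])
      (auto simp: is_binomial_stein_solution_def)
qed

end

theory Submission
  imports Defs
begin

text \<open>
  With \<open>a\<^sub>k = P(Z < k)\<close>, \<open>b\<^sub>k = 1 - a\<^sub>k\<close> and \<open>c\<^sub>k = q k P(Z = k)\<close>, every solution satisfies
  \<open>\<bar>f\<^sub>A(k)\<bar> \<le> R\<^sub>k = a\<^sub>k b\<^sub>k / c\<^sub>k\<close>. Since \<open>1 / R\<^sub>k\<close> is the difference of the conditional means of \<open>Z\<close>
  given \<open>Z \<ge> k\<close> and \<open>Z < k\<close>, \<open>R\<^sub>k \<le> 1\<close>. At an index \<open>k\<close> maximizing \<open>R\<close>, the relations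
  \<open>R\<^sub>k\<^sub>+\<^sub>1 \<le> R\<^sub>k\<close> and \<open>R\<^sub>k\<^sub>-\<^sub>1 \<le> R\<^sub>k\<close> confine \<open>b\<^sub>k - a\<^sub>k\<close> to an interval; together with
  \<open>(b\<^sub>k - a\<^sub>k)\<^sup>2 = 1 - 4 R\<^sub>k c\<^sub>k\<close> this gives \<open>R\<^sub>k\<^sup>2 (2 (n + 1) p q + B(k)) \<le> 1\<close>, where \<open>B(k)\<close> is the
  bracket minimized in \<open>\<kappa>\<close> with \<open>p\<close> in place of \<open>s\<close>. The bracket is invariant under
  \<open>p \<leftrightarrow> q\<close>, \<open>k \<leftrightarrow> n + 1 - k\<close>, and the index \<open>n\<close> missing in \<open>\<kappa>\<close> is dominated by the index \<open>1\<close>.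
\<close>

section \<open>The bracket, its symmetry and its minimum\<close>

definition bin_bracket :: "nat \<Rightarrow> real \<Rightarrow> real \<Rightarrow> real" where
  "bin_bracket n p k = (k - (real n + 1) * p)\<^sup>2
     + (p * (1 - p) * (real n + 1 - 2 * k) / ((1 - p) * k + p * (real n - k + 1)))\<^sup>2"

lemma bin_bracket_nonneg: "bin_bracket n p k \<ge> 0"
  by (simp add: bin_bracket_def)

lemma bin_bracket_reflect: "bin_bracket n p k = bin_bracket n (1 - p) (real n + 1 - k)"
proof -
  have 1: "real n + 1 - k - (real n + 1) * (1 - p) = - (k - (real n + 1) * p)"
    and 2: "(1 - p) * (1 - (1 - p)) * (real n + 1 - 2 * (real n + 1 - k))
      = - (p * (1 - p) * (real n + 1 - 2 * k))"
    and 3: "(1 - (1 - p)) * (real n + 1 - k) + (1 - p) * (real n - (real n + 1 - k) + 1)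
      = (1 - p) * k + p * (real n - k + 1)"
    by (simp_all add: algebra_simps)
  show ?thesis
    unfolding bin_bracket_def 1 2 3 by (simp only: power2_minus flip: minus_divide_left)
qed

text \<open>The denominators at the indices 1 and \<open>n\<close> are \<open>u\<close> and
  \<open>v\<close>, the numerators \<open>c\<close> and \<open>- c\<close>. Passing from 1 to
  \<open>n\<close> raises the first square by \<open>v\<^sup>2 - u\<^sup>2\<close> and lowers the
  second by \<open>c\<^sup>2 / (u * v)\<^sup>2\<close> times that amount, which is no more, since
  \<open>c \<le> u * v\<close> and \<open>u \<le> v\<close>.\<close>

lemma bin_bracket_1_le_n:
  assumes "n \<ge> 1" "0 < p" "p \<le> 1 / 2"
  shows "bin_bracket n p 1 \<le> bin_bracket n p (real n)"
proof -
  define N q u v c where "N = real n" and "q = 1 - p" and "u = q + p * N" and "v = q * N + p"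
    and "c = p * q * (N - 1)"
  have N: "N \<ge> 1" and q: "q > 0" "p \<le> q"
    using assms by (auto simp: N_def q_def)
  have u: "u > 0" and v: "v > 0"
    using assms N q by (auto simp: u_def v_def intro!: add_pos_pos)
  have uv: "u * v = p * q * (N\<^sup>2 + 1) + (p\<^sup>2 + q\<^sup>2) * N"
    by (simp add: u_def v_def power2_eq_square algebra_simps)
  have "N - 1 \<le> N\<^sup>2 + 1"
    using N self_le_power[of N 2] by simp
  hence "c \<le> p * q * (N\<^sup>2 + 1)"
    unfolding c_def using assms q by (intro mult_left_mono) auto
  moreover have "(p\<^sup>2 + q\<^sup>2) * N \<ge> 0"
    using N by simp
  ultimately have "c \<le> u * v"
    unfolding uv by linarith
  moreover have "c \<ge> 0"
    using N q assms by (simp add: c_def)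
  ultimately have c: "c\<^sup>2 \<le> (u * v)\<^sup>2"
    by (rule power_mono)
  have vu: "v\<^sup>2 - u\<^sup>2 = (N\<^sup>2 - 1) * (q - p)"
    by (simp add: u_def v_def q_def power2_eq_square algebra_simps)
  have N2: "N\<^sup>2 \<ge> 1"
    using N by simp
  have "(c / u)\<^sup>2 - (c / v)\<^sup>2 = c\<^sup>2 / (u * v)\<^sup>2 * (v\<^sup>2 - u\<^sup>2)"
  proof -
    have "(c / u)\<^sup>2 = c\<^sup>2 / (u * v)\<^sup>2 * v\<^sup>2" "(c / v)\<^sup>2 = c\<^sup>2 / (u * v)\<^sup>2 * u\<^sup>2"
      using u v by (simp_all add: power_divide power_mult_distrib)
    then show ?thesis
      by (simp only: right_diff_distrib)
  qed
  also have "\<dots> \<le> 1 * (v\<^sup>2 - u\<^sup>2)"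
    using c u v N2 q unfolding vu by (intro mult_right_mono) auto
  also have "\<dots> = (N - (N + 1) * p)\<^sup>2 - (1 - (N + 1) * p)\<^sup>2"
    unfolding vu by (simp add: q_def power2_eq_square algebra_simps)
  finally have "(1 - (N + 1) * p)\<^sup>2 + (c / u)\<^sup>2 \<le> (N - (N + 1) * p)\<^sup>2 + (c / v)\<^sup>2"
    by simp
  moreover have "bin_bracket n p 1 = (1 - (N + 1) * p)\<^sup>2 + (c / u)\<^sup>2"
    by (simp add: bin_bracket_def N_def q_def u_def c_def)
  moreover have "bin_bracket n p (real n) = (N - (N + 1) * p)\<^sup>2 + (- c / v)\<^sup>2"
    by (simp add: bin_bracket_def N_def q_def v_def c_def algebra_simps)
  ultimately show ?thesis
    by simp
qed

lemma kappa_Bin_eq_Min: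
  "kappa_Bin n p = (MIN k\<in>{1..n - 1}. bin_bracket n (min p (1 - p)) (real k))"
proof -
  have "max p (1 - p) = 1 - min p (1 - p)"
    by (simp add: min_def max_def)
  then show ?thesis
    by (simp add: kappa_Bin_def bin_bracket_def Let_def)
qed

lemma kappa_Bin_nonneg:
  assumes "n \<ge> 2"
  shows "kappa_Bin n p \<ge> 0"
  unfolding kappa_Bin_eq_Min using assms
  by (subst Min_ge_iff) (auto simp: bin_bracket_nonneg)

lemma kappa_Bin_le_bracket:
  assumes "n \<ge> 2" "0 < p" "p < 1" "1 \<le> k" "k \<le> n"
  shows "kappa_Bin n p \<le> bin_bracket n p (real k)"
proof -
  let ?s = "min p (1 - p)"
  have *: "kappa_Bin n p \<le> bin_bracket n ?s (real j)" if "1 \<le> j" "j \<le> n" for j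
  proof (cases "j = n")
    case True
    have "kappa_Bin n p \<le> bin_bracket n ?s (real 1)"
      unfolding kappa_Bin_eq_Min using assms(1)
      by (intro Min_le) (auto intro!: image_eqI[where x = 1])
    also have "\<dots> \<le> bin_bracket n ?s (real n)"
      using bin_bracket_1_le_n[of n ?s] assms by (auto simp: min_def)
    finally show ?thesis
      using True by simp
  next
    case False
    then show ?thesis
      unfolding kappa_Bin_eq_Min using that by (intro Min_le) auto
  qed
  show ?thesis
  proof (cases "p \<le> 1 - p")
    case True
    then show ?thesis
      using *[of k] assms by (simp add: min_def)
  next
    case False
    have "bin_bracket n p (real k) = bin_bracket n ?s (real (n + 1 - k))"
      using False assms by (subst bin_bracket_reflect) (simp add: min_def of_nat_diff)
    then show ?thesis
      using *[of "n + 1 - k"] assms by simp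
  qed
qed

text \<open>
  Here \<open>\<alpha> = q k\<close>, \<open>\<beta> = p (n - k + 1)\<close>, \<open>f = R\<^sub>k\<close>, \<open>d = b\<^sub>k - a\<^sub>k\<close>, and the two bounds on \<open>d\<close> are the
  maximality conditions.
\<close>
lemma local_max_bound:
  fixes \<alpha> \<beta> p q f c d :: real
  assumes pos: "\<alpha> > 0" "\<beta> > 0" "f > 0" "p > 0" "q > 0" and pq: "p + q = 1"
    and p: "p \<le> \<alpha> + \<beta>" and q: "q \<le> \<alpha> + \<beta>"
    and d: "4 * f * c = 1 - d\<^sup>2"
    and upper: "d \<le> c / \<alpha> + (\<beta> - \<alpha> - p) * f"
    and lower: "d \<ge> (\<beta> - \<alpha> + q) * f - c / \<beta>"
  shows "f\<^sup>2 * (2 * (p * \<alpha> + q * \<beta>) + (\<beta> - \<alpha>)\<^sup>2 + ((q * \<beta> - p * \<alpha>) / (\<alpha> + \<beta>))\<^sup>2) \<le> 1"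
proof -
  \<comment> \<open>In these variables the bounds read \<open>z * f - e * (\<alpha> / S) \<le> d
    \<le> z * f + e * (\<beta> / S)\<close>. As \<open>\<alpha> + \<beta> = S\<close>, the length of
    this interval is \<open>e\<close>, which is therefore nonnegative.\<close>
  define S y z where "S = \<alpha> + \<beta>" and "y = (q * \<beta> - p * \<alpha>) / S" and "z = \<beta> - \<alpha> + y"
  define g where "g = c * S / (\<alpha> * \<beta>)"
  define e where "e = g - f"
  have S: "S > 0"
    using pos by (simp add: S_def)
  have ca: "c / \<alpha> = g * (\<beta> / S)" and cb: "c / \<beta> = g * (\<alpha> / S)" and c: "c = g * (\<alpha> * \<beta> / S)"
    using pos S by (simp_all add: g_def)
  have q': "q = 1 - p"
    using pq by simp
  have yp: "\<beta> / S = y + p" and yq: "\<alpha> / S = q - y"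
    using S by (simp_all add: y_def q' field_simps) (simp_all add: S_def algebra_simps)
  have upper': "d \<le> z * f + e * (\<beta> / S)"
    using upper unfolding ca by (simp add: yp z_def e_def algebra_simps)
  have lower': "d \<ge> z * f - e * (\<alpha> / S)"
    using lower unfolding cb by (simp add: yq z_def e_def algebra_simps)
  have "e * (\<alpha> / S) + e * (\<beta> / S) \<ge> 0"
    using upper' lower' by simp
  moreover have "e * (\<alpha> / S) + e * (\<beta> / S) = e"
    by (simp add: yp yq q' algebra_simps)
  ultimately have e: "e \<ge> 0"
    by simp
  have "y + p > 0" "q - y > 0"
    using pos S by (simp_all flip: yp yq)
  hence y: "y \<le> S" "- y \<le> S"
    using p q by (simp_all add: S_def)
  \<comment> \<open>The tangent of the square at \<open>z * f\<close> makes \<open>key\<close> a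
    question linear in \<open>d\<close>. The sign of \<open>z\<close> selects the end of the
    interval to use; there \<open>y \<le> S\<close> gives \<open>z \<le> 2 * \<beta>\<close>, and
    \<open>- y \<le> S\<close> gives \<open>- z \<le> 2 * \<alpha>\<close>.\<close>
  have sq: "d\<^sup>2 \<ge> 2 * (z * f) * d - (z * f)\<^sup>2"
    using zero_le_power2[of "d - z * f"] by (simp add: power2_diff algebra_simps)
  have key: "d\<^sup>2 + 4 * f * e * (\<alpha> * \<beta> / S) \<ge> (z * f)\<^sup>2"
  proof (cases "z \<ge> 0")
    case True
    have "2 * (z * f) * d \<ge> 2 * (z * f) * (z * f - e * (\<alpha> / S))"
      using True pos lower' by (intro mult_left_mono) auto
    moreover have "2 * f * e * (\<alpha> / S) * z \<le> 2 * f * e * (\<alpha> / S) * (2 * \<beta>)"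
      using y pos e S by (intro mult_left_mono) (auto simp: z_def S_def)
    ultimately show ?thesis
      using sq by (simp add: algebra_simps power2_eq_square)
  next
    case False
    have "2 * (- z * f) * d \<le> 2 * (- z * f) * (z * f + e * (\<beta> / S))"
      using False pos upper' by (intro mult_left_mono) (auto simp: mult_le_0_iff)
    moreover have "2 * f * e * (\<beta> / S) * (- z) \<le> 2 * f * e * (\<beta> / S) * (2 * \<alpha>)"
      using y pos e S by (intro mult_left_mono) (auto simp: z_def S_def)
    ultimately show ?thesis
      using sq by (simp add: algebra_simps power2_eq_square)
  qed
  \<comment> \<open>Completing the square: the missing cross term
    \<open>2 * (\<beta> - \<alpha>) * y\<close> equals
    \<open>2 * (p * \<alpha> + q * \<beta>)\<close> up to
    \<open>4 * (\<alpha> * \<beta> / S)\<close>.\<close>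
  have "2 * (p * \<alpha> + q * \<beta>) + (\<beta> - \<alpha>)\<^sup>2 + y\<^sup>2 = 4 * (\<alpha> * \<beta> / S) + z\<^sup>2"
  proof -
    have "2 * (\<beta> - \<alpha>) * y = 2 * (p * \<alpha> + q * \<beta>) - 4 * (\<alpha> * \<beta> / S)"
      using S by (simp add: y_def q' field_simps) (simp add: S_def algebra_simps)
    then show ?thesis
      by (simp add: z_def power2_sum)
  qed
  hence "f\<^sup>2 * (2 * (p * \<alpha> + q * \<beta>) + (\<beta> - \<alpha>)\<^sup>2 + y\<^sup>2) = 4 * f * f * (\<alpha> * \<beta> / S) + (z * f)\<^sup>2"
    by (simp add: power2_eq_square algebra_simps)
  also have "\<dots> \<le> 4 * f * f * (\<alpha> * \<beta> / S) + d\<^sup>2 + 4 * f * e * (\<alpha> * \<beta> / S)"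
    using key by simp
  \<comment> \<open>Since \<open>g = f + e\<close>, the two outer terms combine to
    \<open>4 * f * c\<close>.\<close>
  also have "\<dots> = d\<^sup>2 + 4 * f * c"
    unfolding c by (simp add: e_def algebra_simps)
  also have "\<dots> = 1"
    using d by simp
  finally show ?thesis
    by (simp add: y_def S_def)
qed

section \<open>Binomial weights and the ratio \<open>R\<close>\<close>

locale binomial_stein =
  fixes n :: nat and p :: real
  assumes n: "n \<ge> 1" and p: "0 < p" "p < 1"
begin

definition w :: "nat \<Rightarrow> real" where
  "w k = pmf (binomial_pmf n p) k"

definition a :: "nat \<Rightarrow> real" where
  "a k = (\<Sum>j<k. w j)"

definition c :: "nat \<Rightarrow> real" where
  "c k = (1 - p) * real k * w k"

definition R :: "nat \<Rightarrow> real" where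
  "R k = a k * (1 - a k) / c k"

lemma w_eq: "w k = real (n choose k) * p ^ k * (1 - p) ^ (n - k)"
  using p by (simp add: w_def)

lemma w_pos: "k \<le> n \<Longrightarrow> w k > 0"
  using p by (simp add: w_eq)

lemma w_nonneg: "w k \<ge> 0"
  by (simp add: w_def)

text \<open>This balance of neighbouring weights makes the Stein equation telescope: multiplied by
  \<open>w k\<close>, its left side becomes \<open>c (k + 1) * f (k + 1) - c k * f k\<close>. At
  \<open>k = n\<close> both sides vanish.\<close>

lemma c_Suc:
  assumes "k \<le> n"
  shows "c (Suc k) = p * (real n - real k) * w k"
proof (cases "k < n")
  case True
  have 1: "real (Suc k) * real (n choose Suc k) = (real n - real k) * real (n choose k)"
    using binomial_absorb_comp[of n k] binomial_absorption[of k n] assms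
    by (metis of_nat_diff of_nat_mult)
  have 2: "(1 - p) ^ (n - k) = (1 - p) * (1 - p) ^ (n - Suc k)"
    using True by (metis Suc_diff_Suc power_Suc)
  have "c (Suc k) = (real (Suc k) * real (n choose Suc k)) * (p * p ^ k)
      * ((1 - p) * (1 - p) ^ (n - Suc k))"
    by (simp add: c_def w_eq)
  also have "\<dots> = p * (real n - real k) * w k"
    unfolding 1 2[symmetric] by (simp add: w_eq)
  finally show ?thesis .
next
  case False
  then show ?thesis
    using assms by (simp add: c_def w_eq)
qed

lemma c_pos: "1 \<le> k \<Longrightarrow> k \<le> n \<Longrightarrow> c k > 0"
  using p w_pos by (simp add: c_def)

lemma a_Suc: "a (Suc k) = a k + w k"
  by (simp add: a_def)

lemma a_total: "a (Suc n) = 1"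
  unfolding a_def w_eq lessThan_Suc_atMost using binomial_ring[of p "1 - p" n] by simp

lemma a_nonneg: "a k \<ge> 0"
  by (simp add: a_def sum_nonneg w_nonneg)

lemma sum_split: "k \<le> Suc n \<Longrightarrow> (\<Sum>j<Suc n. g j) = (\<Sum>j<k. g j) + (\<Sum>j\<in>{k..n}. (g j :: real))"
proof -
  assume "k \<le> Suc n"
  then have "{..<Suc n} = {..<k} \<union> {k..n}"
    by auto
  then show ?thesis
    by (metis finite_atLeastAtMost finite_lessThan ivl_disj_int_one(2) ivl_disj_int_two(1)
        sum.union_disjoint disjoint_iff lessThan_iff atLeastAtMost_iff not_less)
qed

lemma b_eq: "k \<le> Suc n \<Longrightarrow> 1 - a k = (\<Sum>j\<in>{k..n}. w j)"
  using sum_split[of k w] a_total by (simp add: a_def)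

lemma b_nonneg: "k \<le> Suc n \<Longrightarrow> 1 - a k \<ge> 0"
  by (simp add: b_eq sum_nonneg w_nonneg)

lemma a_pos: "1 \<le> k \<Longrightarrow> a k > 0"
  unfolding a_def using w_pos[of 0] w_nonneg by (intro sum_pos2[of _ 0]) auto

lemma b_pos: "k \<le> n \<Longrightarrow> 1 - a k > 0"
  using w_pos[of n] w_nonneg by (subst b_eq) (auto intro!: sum_pos2[of _ n])

lemma R_c: "1 \<le> k \<Longrightarrow> k \<le> n \<Longrightarrow> R k * c k = a k * (1 - a k)"
  using c_pos[of k] by (simp add: R_def)

lemma R_pos: "1 \<le> k \<Longrightarrow> k \<le> n \<Longrightarrow> R k > 0"
  using a_pos b_pos c_pos by (simp add: R_def)

text \<open>The increment of \<open>c\<close> at \<open>k\<close> is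
  \<open>p * (n - k) * w k - (1 - p) * k * w k\<close>. The sum ties \<open>c\<close> to truncated
  means.\<close>

lemma c_eq_sum: "k \<le> Suc n \<Longrightarrow> c k = (\<Sum>j<k. (real n * p - real j) * w j)"
proof (induction k)
  case 0
  then show ?case by (simp add: c_def)
next
  case (Suc k)
  have "c (Suc k) - c k = (real n * p - real k) * w k"
    using Suc.prems by (simp add: c_Suc) (simp add: c_def algebra_simps)
  then show ?case using Suc by simp
qed

text \<open>Dividing \<open>c k = a k * U - (1 - a k) * L\<close> by \<open>a k * (1 - a k)\<close>
  gives the gap between the conditional means. It is at least 1, as the values below
  \<open>k\<close> are at most \<open>k - 1\<close>.\<close>

lemma R_le_1:
  assumes k: "1 \<le> k" "k \<le> n"
  shows "R k \<le> 1"
proof -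
  define L U where "L = (\<Sum>j<k. real j * w j)" and "U = (\<Sum>j\<in>{k..n}. real j * w j)"
  \<comment> \<open>With this, \<open>c_eq_sum\<close> at \<open>n + 1\<close> says that the mean is
    \<open>n * p\<close>.\<close>
  have "c (Suc n) = 0"
    using c_Suc[of n] by simp
  hence mean: "real n * p = L + U"
    using c_eq_sum[of "Suc n"] a_total sum_split[of k "\<lambda>j. real j * w j"] k
    by (simp add: left_diff_distrib sum_subtractf a_def L_def U_def del: sum.lessThan_Suc
        flip: sum_distrib_left)
  have "c k = real n * p * a k - L"
    using k by (simp add: c_eq_sum left_diff_distrib sum_subtractf a_def L_def
        flip: sum_distrib_left)
  hence ck: "c k = a k * U - (1 - a k) * L"
    unfolding mean by (simp add: algebra_simps)
  have "L \<le> (\<Sum>j<k. (real k - 1) * w j)"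
    unfolding L_def using w_nonneg by (intro sum_mono mult_right_mono) auto
  hence "L \<le> (real k - 1) * a k"
    by (simp add: a_def sum_distrib_left)
  hence L: "(1 - a k) * L \<le> (1 - a k) * ((real k - 1) * a k)"
    using b_nonneg k by (intro mult_left_mono) auto
  have "U \<ge> (\<Sum>j\<in>{k..n}. real k * w j)"
    unfolding U_def using w_nonneg by (intro sum_mono mult_right_mono) auto
  hence "U \<ge> real k * (1 - a k)"
    using k by (simp add: b_eq sum_distrib_left)
  hence "a k * U \<ge> a k * (real k * (1 - a k))"
    using a_nonneg by (intro mult_left_mono) auto
  hence "c k \<ge> a k * (1 - a k)"
    using L unfolding ck by (simp add: algebra_simps)
  then show ?thesis
    using c_pos k by (simp add: R_def)
qed

section \<open>Bounding all Stein solutions by \<open>R\<close>\<close>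

lemma binomial_stein_solution:
  "A \<subseteq> {0..n} \<Longrightarrow> is_binomial_stein_solution n p A (binomial_stein_solution n p A)"
  unfolding binomial_stein_solution_def using ex1_binomial_stein_solution[OF p] by (rule theI')

text \<open>\<open>L\<close> and \<open>U\<close> are the masses of \<open>A\<close> below
  \<open>k\<close> and from \<open>k\<close> on. Then
  \<open>c k * f k = (1 - a k) * L - a k * U\<close> is a difference of two numbers between 0 and
  \<open>a k * (1 - a k)\<close>.\<close>

lemma solution_le_R:
  assumes A: "A \<subseteq> {0..n}" and k: "1 \<le> k" "k \<le> n"
  shows "\<bar>binomial_stein_solution n p A k\<bar> \<le> R k"
proof -
  define f where "f = binomial_stein_solution n p A"
  define P where "P = measure_pmf.prob (binomial_pmf n p) A"
  define L U where "L = (\<Sum>j<k. w j * indicator A j)" and "U = (\<Sum>j\<in>{k..n}. w j * indicator A j)"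
  have "is_binomial_stein_solution n p A f"
    unfolding f_def using A by (rule binomial_stein_solution)
  hence f: "p * (real n - real j) * f (Suc j) - (1 - p) * real j * f j = indicator A j - P"
    if "j \<le> n" for j
    using that by (auto simp: is_binomial_stein_solution_def P_def)
  have cf: "c j * f j = (\<Sum>i<j. w i * (indicator A i - P))" if "j \<le> n" for j
    using that
  proof (induction j)
    case 0
    then show ?case by (simp add: c_def)
  next
    case (Suc j)
    have "c (Suc j) * f (Suc j) = c j * f j + w j * (indicator A j - P)"
      unfolding c_Suc[OF Suc_leD[OF Suc.prems]] f[OF Suc_leD[OF Suc.prems], symmetric]
      by (simp add: c_def algebra_simps)
    then show ?case using Suc by simp
  qed
  have "P = (\<Sum>j\<in>A. w j)"
    using A finite_subset[OF A] by (simp add: P_def w_def measure_measure_pmf_finite)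
  also have "\<dots> = (\<Sum>j<Suc n. w j * indicator A j)"
    using A by (intro sum.mono_neutral_cong_left) (auto simp: indicator_def)
  finally have P: "P = L + U"
    using k sum_split[of k "\<lambda>j. w j * indicator A j"] by (simp add: L_def U_def)
  have "c k * f k = L - P * a k"
  proof -
    have "c k * f k = (\<Sum>i<k. w i * indicator A i - P * w i)"
      using k by (subst cf) (auto simp: algebra_simps)
    then show ?thesis
      by (simp only: L_def a_def sum_subtractf sum_distrib_left)
  qed
  hence cfk: "c k * f k = (1 - a k) * L - a k * U"
    unfolding P by (simp add: algebra_simps)
  have L: "0 \<le> L" "L \<le> a k"
    unfolding L_def a_def using w_nonneg
    by (intro sum_nonneg sum_mono; simp add: indicator_def)+
  have U: "0 \<le> U" "U \<le> 1 - a k"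
    unfolding U_def b_eq[OF le_SucI[OF k(2)]] using w_nonneg
    by (intro sum_nonneg sum_mono; simp add: indicator_def)+
  have "0 \<le> (1 - a k) * L" "(1 - a k) * L \<le> (1 - a k) * a k"
    "0 \<le> a k * U" "a k * U \<le> a k * (1 - a k)"
    using L U a_nonneg b_pos[of k] k by (auto intro!: mult_left_mono)
  hence "\<bar>c k * f k\<bar> \<le> a k * (1 - a k)"
    unfolding cfk by (simp add: mult.commute)
  then show ?thesis
    using c_pos[OF k] by (simp add: R_def abs_mult field_simps flip: f_def)
qed

lemma C0_Bin_le_Max: "C0_Bin n p \<le> (MAX k\<in>{1..n}. R k)"
  unfolding C0_Bin_def
proof (rule cSUP_least)
  fix A assume A: "A \<in> Pow {0..n}"
  have fin: "finite (R ` {1..n})"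
    by simp
  have "\<bar>binomial_stein_solution n p A k\<bar> \<le> (MAX k\<in>{1..n}. R k)" if "k \<le> n" for k
  proof (cases "k = 0")
    case True
    have "is_binomial_stein_solution n p A (binomial_stein_solution n p A)"
      using A by (intro binomial_stein_solution) auto
    hence "\<bar>binomial_stein_solution n p A k\<bar> \<le> R 1"
      using R_pos[of 1] n True by (simp add: is_binomial_stein_solution_def)
    also have "\<dots> \<le> (MAX k\<in>{1..n}. R k)"
      using fin n by (intro Max_ge) auto
    finally show ?thesis .
  next
    case False
    have "\<bar>binomial_stein_solution n p A k\<bar> \<le> R k"
      using A False that by (intro solution_le_R) auto
    also have "\<dots> \<le> (MAX k\<in>{1..n}. R k)"
      using fin False that by (intro Max_ge) auto
    finally show ?thesis .
  qed
  then show "max_norm n (binomial_stein_solution n p A) \<le> (MAX k\<in>{1..n}. R k)"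
    by (auto simp: max_norm_def)
qed auto

section \<open>The maximum of \<open>R\<close>\<close>

lemma R_Suc:
  assumes "1 \<le> k" "k < n"
  shows "p * (real n - real k) * R (Suc k) = (1 - p) * real k * R k + (1 - 2 * a k) - w k"
proof -
  have "w k * (p * (real n - real k) * R (Suc k)) = R (Suc k) * c (Suc k)"
    using assms by (simp add: c_Suc)
  also have "\<dots> = a (Suc k) * (1 - a (Suc k))"
    using assms by (intro R_c) auto
  also have "\<dots> = R k * c k + w k * (1 - 2 * a k) - w k * w k"
    using assms by (simp add: R_c a_Suc algebra_simps)
  also have "\<dots> = w k * ((1 - p) * real k * R k + (1 - 2 * a k) - w k)"
    by (simp add: c_def algebra_simps)
  finally show ?thesis
    using w_pos[of k] assms by simp
qed

text \<open>With these \<open>\<alpha>\<close> and \<open>\<beta>\<close>, the quotients of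
  \<open>c k\<close> by them are \<open>w k\<close> and \<open>w (k - 1)\<close>. So
  \<open>R_Suc\<close> at \<open>k\<close> and at \<open>k - 1\<close> turns maximality into the two
  bounds required by \<open>local_max_bound\<close>.\<close>

lemma maximizer_bound:
  assumes k: "1 \<le> k" "k \<le> n" and max: "\<And>j. 1 \<le> j \<Longrightarrow> j \<le> n \<Longrightarrow> R j \<le> R k"
  shows "(R k)\<^sup>2 * (2 * (real n + 1) * p * (1 - p) + bin_bracket n p (real k)) \<le> 1"
proof -
  define q \<alpha> \<beta> where "q = 1 - p" and "\<alpha> = q * real k" and "\<beta> = p * (real n - real k + 1)"
  have q: "q > 0"
    using p by (simp add: q_def)
  have k': "real k \<ge> 1" "real k \<le> real n"
    using k by auto
  have "q * 1 \<le> \<alpha>" "p * 1 \<le> \<beta>"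
    unfolding \<alpha>_def \<beta>_def using q p k' by (auto intro!: mult_left_mono)
  hence \<alpha>: "q \<le> \<alpha>" "\<alpha> > 0" and \<beta>: "p \<le> \<beta>" "\<beta> > 0"
    using p q by auto
  have wk: "w k = c k / \<alpha>"
    using k p by (auto simp: c_def \<alpha>_def q_def)
  have wk': "w (k - 1) = c k / \<beta>"
    using \<beta> k c_Suc[of "k - 1"]
    by (auto simp: \<beta>_def of_nat_diff field_simps)
  have upper: "1 - 2 * a k \<le> c k / \<alpha> + (\<beta> - \<alpha> - p) * R k"
  proof (cases "k = n")
    \<comment> \<open>There is no right neighbour, but \<open>\<beta> = p\<close> here and the bound
      is an equality.\<close>
    case True
    have "1 - a k = w k"
      using a_total a_Suc[of n] True by simp
    moreover have "R k * \<alpha> = a k"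
      using R_c[OF k] c_pos[OF k] w_pos[of k] k calculation by (simp add: c_def \<alpha>_def q_def)
    ultimately show ?thesis
      using True wk by (simp add: \<beta>_def algebra_simps)
  next
    case False
    have "p * (real n - real k) * R (Suc k) \<le> p * (real n - real k) * R k"
      using False k p by (intro mult_left_mono max) auto
    then show ?thesis
      unfolding wk[symmetric] using R_Suc[of k] False k
      by (simp add: \<alpha>_def \<beta>_def q_def algebra_simps)
  qed
  have lower: "1 - 2 * a k \<ge> (\<beta> - \<alpha> + q) * R k - c k / \<beta>"
  proof (cases "k = 1")
    \<comment> \<open>There is no left neighbour, but \<open>\<alpha> = q\<close> here and the bound
      is an equality.\<close>
    case True
    have "a k = w (k - 1)"
      using True by (simp add: a_def)
    moreover have "R k * \<beta> = 1 - a k"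
    proof -
      have "c k = \<beta> * a k"
        using wk' \<beta> calculation by simp
      then show ?thesis
        using R_c[OF k] a_pos[of k] k by simp
    qed
    ultimately show ?thesis
      using True wk' by (simp add: \<alpha>_def algebra_simps)
  next
    case False
    have "q * (real k - 1) * R (k - 1) \<le> q * (real k - 1) * R k"
      using False k q by (intro mult_left_mono max) auto
    moreover have "a k = a (k - 1) + w (k - 1)"
      using a_Suc[of "k - 1"] k by simp
    moreover have "\<beta> * R k = q * (real k - 1) * R (k - 1) + (1 - 2 * a (k - 1)) - w (k - 1)"
      using R_Suc[of "k - 1"] False k by (simp add: \<beta>_def q_def of_nat_diff algebra_simps)
    ultimately show ?thesis
      unfolding wk'[symmetric] by (simp add: \<alpha>_def algebra_simps)
  qed
  have "(R k)\<^sup>2 * (2 * (p * \<alpha> + q * \<beta>) + (\<beta> - \<alpha>)\<^sup>2 + ((q * \<beta> - p * \<alpha>) / (\<alpha> + \<beta>))\<^sup>2) \<le> 1"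
    using \<alpha> \<beta> p q R_pos[OF k] R_c[OF k] upper lower
    by (intro local_max_bound[where c = "c k" and d = "1 - 2 * a k"])
      (auto simp: q_def power2_eq_square algebra_simps)
  also have "p * \<alpha> + q * \<beta> = (real n + 1) * p * q"
    by (simp add: \<alpha>_def \<beta>_def algebra_simps)
  also have "(\<beta> - \<alpha>)\<^sup>2 = (real k - (real n + 1) * p)\<^sup>2"
    by (subst power2_commute) (simp add: \<alpha>_def \<beta>_def q_def algebra_simps)
  also have "q * \<beta> - p * \<alpha> = p * q * (real n + 1 - 2 * real k)"
    by (simp add: \<alpha>_def \<beta>_def algebra_simps)
  finally show ?thesis
    by (simp add: bin_bracket_def \<alpha>_def \<beta>_def q_def mult.assoc add.assoc del: distrib_left_numeral)
qed

text \<open>\<open>D\<close> serves both estimates: the bracket is either dropped as nonnegative or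
  bounded below by \<open>kappa_Bin n p\<close>.\<close>

lemma C0_Bin_bound:
  assumes D: "D > 0"
    and le: "\<And>k. 1 \<le> k \<Longrightarrow> k \<le> n \<Longrightarrow> D \<le> 2 * (real n + 1) * p * (1 - p) + bin_bracket n p (real k)"
  shows "C0_Bin n p \<le> min 1 (1 / sqrt D)"
proof -
  have "(MAX k\<in>{1..n}. R k) \<in> R ` {1..n}"
    using n by (intro Max_in) auto
  then obtain k where k: "1 \<le> k" "k \<le> n" and Rk: "(MAX k\<in>{1..n}. R k) = R k"
    by auto
  have max: "R j \<le> R k" if "1 \<le> j" "j \<le> n" for j
    unfolding Rk[symmetric] using that by (intro Max_ge) auto
  have "(R k)\<^sup>2 * D \<le> (R k)\<^sup>2 * (2 * (real n + 1) * p * (1 - p) + bin_bracket n p (real k))"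
    by (intro mult_left_mono le k) auto
  also have "\<dots> \<le> 1"
    using k max by (rule maximizer_bound)
  finally have "sqrt ((R k)\<^sup>2 * D) \<le> 1"
    by simp
  hence "R k * sqrt D \<le> 1"
    using R_pos[OF k] by (simp add: real_sqrt_mult)
  hence "R k \<le> 1 / sqrt D"
    using D by (simp add: field_simps)
  then show ?thesis
    using C0_Bin_le_Max R_le_1[OF k] Rk by simp
qed

end

theorem corollary5p3:
  fixes n :: nat and p q :: real
  assumes "n \<ge> 1" and "0 < p" and "p < 1" and "q = 1 - p"
  shows "C0_Bin n p \<le> min 1 (1 / sqrt (2 * (real n + 1) * p * q)) \<and>
         (n \<ge> 2 \<longrightarrow>
            C0_Bin n p \<le> min 1 (1 / sqrt (2 * (real n + 1) * p * q + kappa_Bin n p)))"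
proof -
  interpret binomial_stein n p
    using assms by unfold_locales
  have pos: "2 * (real n + 1) * p * q > 0"
    using assms by simp
  show ?thesis
  proof (intro conjI impI)
    show "C0_Bin n p \<le> min 1 (1 / sqrt (2 * (real n + 1) * p * q))"
      using pos assms(4) by (intro C0_Bin_bound) (auto simp: bin_bracket_nonneg)
    assume "n \<ge> 2"
    then show "C0_Bin n p \<le> min 1 (1 / sqrt (2 * (real n + 1) * p * q + kappa_Bin n p))"
      using add_pos_nonneg[OF pos kappa_Bin_nonneg] assms kappa_Bin_le_bracket[of n p]
      by (intro C0_Bin_bound) auto
  qed
qed

end
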